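(* Let $G_1$ and $G_2$ be graphs and let $H = G_1 \circ G_2$. For any subgraph $G_1'$ of $G_1$, $G_1'$ is a comparability graph if and only if the lexicographic map $\mathcal{L}_H(G_1')$ is a comparability graph.
   Context: All graphs are simple, undirected and finite. A comparability graph is a graph whose edges admit a transitive orientation ($a\to b$ and $b \to c$ imply $a \to c$). The lexicographic product $H = G_1 \circ G_2$ has vertex set $V(G_1)\times V(G_2)$, with $(u,v)$ and $(x,y)$ adjacent iff $\{u,x\}\in E(G_1)$, or $u=x$ and $\{v,y\}\in E(G_2)$. For $v_i \in V(G_1)$ the supervertex $V_i = \{(v_i,u) : u \in V(G_2)\}$. For a subgraph $G_1'$ of $G_1$, the lexicographic map $\mathcal{L}_H(G_1')$ is the subgraph of $H$ on vertex set $V(H)$ containing no edges inside any supervertex and, for each edge $v_iv_j \in E(G_1')$, all edges between $V_i$ and $V_j$ (and no other edges). *)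

theory Defs
  imports "Graph_Theory.Graph_Theory"
begin

text \<open>
  Finite simple undirected graphs are \<^locale>\<open>pair_graph\<close>s: an edge between \<open>u\<close> and \<open>v\<close> is
  represented by the two arcs \<open>(u, v)\<close> and \<open>(v, u)\<close>. The locale admits the empty vertex set.
  An orientation therefore selects exactly one of the two arcs of every edge.
\<close>

definition orientation :: "'a pair_pre_digraph \<Rightarrow> 'a rel \<Rightarrow> bool" where
  "orientation G T \<longleftrightarrow> T \<union> T\<inverse> = parcs G \<and> T \<inter> T\<inverse> = {}"

definition comparability_graph :: "'a pair_pre_digraph \<Rightarrow> bool" where
  "comparability_graph G \<longleftrightarrow> pair_graph G \<and> (\<exists>T. orientation G T \<and> trans T)"

definition lex_product ::
    "'a pair_pre_digraph \<Rightarrow> 'b pair_pre_digraph \<Rightarrow> ('a \<times> 'b) pair_pre_digraph" where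
  "lex_product G1 G2 =
     \<lparr> pverts = pverts G1 \<times> pverts G2,
       parcs = {((u, v), (x, y)) | u v x y.
         (u, v) \<in> pverts G1 \<times> pverts G2 \<and> (x, y) \<in> pverts G1 \<times> pverts G2 \<and>
         ((u, x) \<in> parcs G1 \<or> u = x \<and> (v, y) \<in> parcs G2)} \<rparr>"

definition supervertex :: "'b pair_pre_digraph \<Rightarrow> 'a \<Rightarrow> ('a \<times> 'b) set" where
  "supervertex G2 v = {(v, u) | u. u \<in> pverts G2}"

text \<open>
  The vertex set is that of the whole product, also when \<open>G'\<close> is not a spanning subgraph of \<open>G1\<close>.
\<close>

definition lex_map ::
    "'a pair_pre_digraph \<Rightarrow> 'b pair_pre_digraph \<Rightarrow> 'a pair_pre_digraph \<Rightarrow>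
     ('a \<times> 'b) pair_pre_digraph" where
  "lex_map G1 G2 G' =
     \<lparr> pverts = pverts (lex_product G1 G2),
       parcs = (\<Union>(v, w) \<in> parcs G'. supervertex G2 v \<times> supervertex G2 w) \<rparr>"

lemma pair_graph_iff:
  "pair_graph G \<longleftrightarrow> finite (pverts G) \<and> parcs G \<subseteq> pverts G \<times> pverts G \<and> sym (parcs G) \<and>
     irrefl (parcs G)" (is "_ = ?R")
proof
  assume "pair_graph G"
  then interpret pair_graph G .
  show ?R
    using pair_sym_arcs pair_no_loops arc_fst_in_verts arc_snd_in_verts pair_finite_verts
    by (fastforce simp: symmetric_def irrefl_def)
next
  assume R: ?R
  then have "finite (parcs G)"
    by (meson finite_SigmaI finite_subset)
  then show "pair_graph G"
    using R by unfold_locales (auto simp: symmetric_def irrefl_def)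
qed

lemma pair_graph_lex_product:
  assumes "pair_graph G1" "pair_graph G2"
  shows "pair_graph (lex_product G1 G2)"
  using assms unfolding pair_graph_iff lex_product_def
  by (auto simp: sym_def irrefl_def)

lemma pair_graph_lex_map:
  assumes "pair_graph G1" "pair_graph G2" "pair_graph G'" "subgraph G' G1"
  shows "pair_graph (lex_map G1 G2 G')"
  using assms unfolding pair_graph_iff lex_map_def lex_product_def supervertex_def subgraph_def
  by (fastforce simp: sym_def irrefl_def)

lemma subgraph_lex_map:
  assumes "pair_graph G1" "pair_graph G2" "pair_graph G'" "subgraph G' G1"
  shows "subgraph (lex_map G1 G2 G') (lex_product G1 G2)"
proof -
  interpret H: pair_graph "lex_product G1 G2"
    using assms by (intro pair_graph_lex_product)
  interpret L: pair_graph "lex_map G1 G2 G'"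
    using assms by (intro pair_graph_lex_map)
  have "parcs (lex_map G1 G2 G') \<subseteq> parcs (lex_product G1 G2)"
    using assms unfolding pair_graph_iff lex_map_def lex_product_def supervertex_def subgraph_def
    by fastforce
  then show ?thesis
    using H.wf_digraph L.wf_digraph by (auto simp: subgraph_def lex_map_def)
qed

end

theory Submission
  imports Defs
begin

text \<open>
  A transitive orientation of \<open>G1'\<close> lifts to the lexicographic map by orienting all edges between
  two supervertices alike. Conversely, for a fixed vertex \<open>c\<close> of \<open>G2\<close> the vertices \<open>(v, c)\<close> induce
  a copy of \<open>G1'\<close>, which inherits a transitive orientation.
\<close>

lemma mem_parcs_lex_map_iff:
  "((u, a), (x, b)) \<in> parcs (lex_map G1 G2 G') \<longleftrightarrow>
     (u, x) \<in> parcs G' \<and> a \<in> pverts G2 \<and> b \<in> pverts G2"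
  unfolding lex_map_def supervertex_def by auto

text \<open>Elementwise form: once arcs of the map and of the orientations are rewritten in
  coordinates, first-order reasoning suffices.\<close>

lemma orientation_iff:
  "orientation G T \<longleftrightarrow>
     (\<forall>u v. (u, v) \<in> T \<or> (v, u) \<in> T \<longleftrightarrow> (u, v) \<in> parcs G) \<and>
     (\<forall>u v. (u, v) \<in> T \<longrightarrow> (v, u) \<notin> T)"
  unfolding orientation_def set_eq_iff split_paired_All by simp

lemma comparability_graph_lex_map:
  fixes G1 G' :: "'a pair_pre_digraph" and G2 :: "'b pair_pre_digraph"
  assumes "pair_graph G1" "pair_graph G2" "subgraph G' G1" "comparability_graph G'"
  shows "comparability_graph (lex_map G1 G2 G')"
proof -
  obtain T where G': "pair_graph G'" and T: "orientation G' T" "trans T"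
    using assms(4) unfolding comparability_graph_def by blast
  \<comment> \<open>The bounds on \<open>a\<close> and \<open>b\<close> keep \<open>S\<close> within
    the arcs of the map.\<close>
  define S where "S = {((u, a), (x, b)). (u, x) \<in> T \<and> a \<in> pverts G2 \<and> b \<in> pverts G2}"
  have S_iff: "((u, a), (x, b)) \<in> S \<longleftrightarrow> (u, x) \<in> T \<and> a \<in> pverts G2 \<and> b \<in> pverts G2"
    for u a x b
    by (simp add: S_def)
  have "orientation (lex_map G1 G2 G') S"
    using T(1) unfolding orientation_iff split_paired_All mem_parcs_lex_map_iff S_iff by blast
  moreover have "trans S"
    using T(2) unfolding trans_def split_paired_All S_iff by blast
  ultimately show ?thesis
    using pair_graph_lex_map[OF assms(1,2) G' assms(3)] unfolding comparability_graph_def by blast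
qed

text \<open>If \<open>G2\<close> had no vertices, the map would be empty, hence a comparability
  graph whatever \<open>G'\<close> is.\<close>

lemma comparability_graph_if_lex_map:
  assumes "pverts G2 \<noteq> {}" "pair_graph G'" "comparability_graph (lex_map G1 G2 G')"
  shows "comparability_graph G'"
proof -
  obtain S where S: "orientation (lex_map G1 G2 G') S" "trans S"
    using assms(3) unfolding comparability_graph_def by blast
  obtain c where c: "c \<in> pverts G2"
    using assms(1) by blast
  define T where "T = {(u, x). ((u, c), (x, c)) \<in> S}"
  have T_iff: "(u, x) \<in> T \<longleftrightarrow> ((u, c), (x, c)) \<in> S" for u x
    by (simp add: T_def)
  \<comment> \<open>Since \<open>c\<close> is a vertex of \<open>G2\<close>, \<open>(u, c)\<close>
    and \<open>(x, c)\<close> are adjacent in the map exactly when \<open>u\<close> and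
    \<open>x\<close> are adjacent in \<open>G'\<close>.\<close>
  have "orientation G' T"
    using S(1) c unfolding orientation_iff split_paired_All mem_parcs_lex_map_iff T_iff by blast
  moreover have "trans T"
    using S(2) unfolding trans_def T_iff by blast
  ultimately show ?thesis
    using assms(2) unfolding comparability_graph_def by blast
qed

theorem theorem5:
  fixes G1 G1' :: "'a pair_pre_digraph" and G2 :: "'b pair_pre_digraph"
  assumes "pair_graph G1" and "pair_graph G2" and "pverts G2 \<noteq> {}"
    and "pair_graph G1'" and "subgraph G1' G1"
  shows "comparability_graph G1' \<longleftrightarrow> comparability_graph (lex_map G1 G2 G1')"
  using comparability_graph_lex_map[OF assms(1,2,5)] comparability_graph_if_lex_map[OF assms(3,4)]
  by (rule iffI)

end
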